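(* There exist a real $3\times 3$ matrix $A$ and a real $1\times 3$ matrix $B$ such that the non-termination set $\mathrm{NT}=\{\vec{x}\in\mathbb{R}^3: BA^k\vec{x}\ge 0 \text{ for all integers } k\ge 0\}$ of the loop "while $(B\vec{x}\ge 0)$ $\{\vec{x}:=A\vec{x}\}$" is not a semi-algebraic set. In particular, non-termination sets of homogeneous simple linear loops with more than two variables cannot in general be defined by Tarski formulae.
   Context: A semi-algebraic subset of $\mathbb{R}^n$ is a set of the form $\bigcup_{i=1}^s\bigcap_{j=1}^{r_i}\{\vec{x}\in\mathbb{R}^n: f_{i,j}(\vec{x})\,\triangleleft_{i,j}\,0\}$ with finitely many polynomials $f_{i,j}\in\mathbb{R}[x_1,\dots,x_n]$ and $\triangleleft_{i,j}\in\{<,=\}$; these are exactly the sets definable by Tarski formulae (Boolean combinations of polynomial equalities and inequalities). *)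

theory Defs
  imports "HOL-Analysis.Analysis"
begin

text \<open>Polynomial functions on real^'n (with real coefficients): the smallest class
  containing the constants and coordinate functions, closed under + and *.
  These are exactly the evaluation maps of polynomials in R[x_1,...,x_n].\<close>
inductive poly_fun :: "(real^'n \<Rightarrow> real) \<Rightarrow> bool" where
  const: "poly_fun (\<lambda>x. c)"
| coord: "poly_fun (\<lambda>x. x $ i)"
| add: "poly_fun f \<Longrightarrow> poly_fun g \<Longrightarrow> poly_fun (\<lambda>x. f x + g x)"
| mult: "poly_fun f \<Longrightarrow> poly_fun g \<Longrightarrow> poly_fun (\<lambda>x. f x * g x)"

text \<open>Semi-algebraic set: finite union (i < s) of finite intersections (j < r i)
  of sets {f_ij < 0} (if lt i j) or {f_ij = 0} (otherwise).\<close>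
definition semialgebraic :: "(real^'n) set \<Rightarrow> bool" where
  "semialgebraic S \<longleftrightarrow>
     (\<exists>(s::nat) (r::nat \<Rightarrow> nat) (f::nat \<Rightarrow> nat \<Rightarrow> real^'n \<Rightarrow> real) (lt::nat \<Rightarrow> nat \<Rightarrow> bool).
        (\<forall>i<s. \<forall>j<r i. poly_fun (f i j)) \<and>
        S = (\<Union>i<s. \<Inter>j<r i. {x. if lt i j then f i j x < 0 else f i j x = 0}))"

text \<open>Non-termination set of the loop  while (B x >= 0) { x := A x }.\<close>
definition NT :: "real^'n^'n \<Rightarrow> real^'n^'m \<Rightarrow> (real^'n) set" where
  "NT A B = {x. \<forall>k::nat. \<forall>i. (B *v (((*v) A ^^ k) x)) $ i \<ge> 0}"

end

theory Submission
  imports Defs "HOL-Computational_Algebra.Polynomial"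
begin

(* Proof idea.  Take A with A^k x = (x1 + k x2 + k^2 x3, x2 + 2k x3, x3) and B = (1 0 0),
   so NT A B = {x. x3 k^2 + x2 k + x1 >= 0 for all k in N}.  Restrict NT A B to the
   polynomial curve gam t = (t^2 - 1/16, -2t, 1): the trace is {t. |k - t| >= 1/4 for all k},
   whose membership switches near every natural number.
   On the other hand, the pullback of any semi-algebraic set along a polynomial curve is a
   Boolean combination of sign conditions of univariate polynomials, hence "finitely
   switching": membership is constant on every interval avoiding some finite set of points. *)

definition finitely_switching :: "real set \<Rightarrow> bool" where
  "finitely_switching S \<longleftrightarrow>
     (\<exists>F. finite F \<and> (\<forall>a b. a \<le> b \<longrightarrow> {a..b} \<inter> F = {} \<longrightarrow> (a \<in> S \<longleftrightarrow> b \<in> S)))"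

text \<open>Finitely switching sets form a Boolean algebra; we need finite unions and intersections.\<close>

lemma finitely_switching_Un:
  "finitely_switching A \<Longrightarrow> finitely_switching B \<Longrightarrow> finitely_switching (A \<union> B)"
  unfolding finitely_switching_def by (metis (no_types, lifting) Int_Un_distrib Un_empty UnE UnI1 UnI2 finite_UnI)

lemma finitely_switching_Int:
  "finitely_switching A \<Longrightarrow> finitely_switching B \<Longrightarrow> finitely_switching (A \<inter> B)"
  unfolding finitely_switching_def by (metis (no_types, lifting) Int_Un_distrib Un_empty IntE IntI finite_UnI)

lemma finitely_switching_Inter:
  "(\<And>j. j < (r::nat) \<Longrightarrow> finitely_switching (S j)) \<Longrightarrow> finitely_switching (\<Inter>j<r. S j)"
proof (induction r)
  case 0
  then show ?case by (auto simp: finitely_switching_def)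
next
  case (Suc r)
  then show ?case by (simp add: lessThan_Suc finitely_switching_Int)
qed

lemma finitely_switching_Union:
  "(\<And>j. j < (r::nat) \<Longrightarrow> finitely_switching (S j)) \<Longrightarrow> finitely_switching (\<Union>j<r. S j)"
proof (induction r)
  case 0
  then show ?case by (auto simp: finitely_switching_def)
next
  case (Suc r)
  then show ?case by (simp add: lessThan_Suc finitely_switching_Un)
qed

text \<open>Sign conditions of a univariate polynomial can only switch at its finitely many roots:
  between two consecutive roots the sign is constant by the intermediate value theorem.\<close>

lemma poly_sign_constant_between_roots:
  fixes p :: "real poly"
  assumes "a \<le> b" and no_root: "\<forall>t\<in>{a..b}. poly p t \<noteq> 0"
  shows "poly p a < 0 \<longleftrightarrow> poly p b < 0"
proof (cases "a = b")
  case False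
  then have "a < b" using assms(1) by simp
  have "\<not> (\<exists>x>a. x < b \<and> poly p x = 0)" using no_root by force
  moreover have "poly p a \<noteq> 0" "poly p b \<noteq> 0" using no_root assms(1) by auto
  ultimately show ?thesis
    using poly_IVT_pos[of a b p] poly_IVT_neg[of a b p] \<open>a < b\<close> by force
qed simp

lemma finitely_switching_poly_sign:
  fixes p :: "real poly"
  shows "finitely_switching {t. poly p t < 0}" and "finitely_switching {t. poly p t = 0}"
proof -
  have "finitely_switching {t. poly p t < 0} \<and> finitely_switching {t. poly p t = 0}"
  proof (cases "p = 0")
    case False
    then have "finite {t. poly p t = 0}" by (rule poly_roots_finite)
    moreover have "\<forall>t\<in>{a..b}. poly p t \<noteq> 0" if "{a..b} \<inter> {t. poly p t = 0} = {}" for a b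
      using that by blast
    ultimately show ?thesis
      unfolding finitely_switching_def
      by (metis (mono_tags, lifting) atLeastAtMost_iff mem_Collect_eq order_refl
          poly_sign_constant_between_roots)
  qed (auto simp: finitely_switching_def)
  then show "finitely_switching {t. poly p t < 0}" "finitely_switching {t. poly p t = 0}"
    by auto
qed

text \<open>A set that switches membership arbitrarily far out is not finitely switching.\<close>

lemma not_finitely_switching_if_unbounded_switches:
  assumes switch: "\<And>M. \<exists>a b. M < a \<and> a \<le> b \<and> (a \<in> S \<longleftrightarrow> b \<notin> S)"
  shows "\<not> finitely_switching S"
proof
  assume "finitely_switching S"
  then obtain F where "finite F"
    and const: "\<And>a b. a \<le> b \<Longrightarrow> {a..b} \<inter> F = {} \<Longrightarrow> (a \<in> S \<longleftrightarrow> b \<in> S)"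
    unfolding finitely_switching_def by blast
  define M where "M = Max (insert 0 F)"
  have bound: "\<forall>x\<in>F. x \<le> M" using \<open>finite F\<close> unfolding M_def by simp
  obtain a b where "M < a" "a \<le> b" "a \<in> S \<longleftrightarrow> b \<notin> S" using switch by blast
  moreover have "{a..b} \<inter> F = {}" using bound \<open>M < a\<close> by force
  ultimately show False using const by blast
qed

text \<open>Polynomial functions composed with a polynomial curve are univariate polynomials.\<close>

lemma poly_fun_along_poly_curve:
  fixes \<gamma> :: "real \<Rightarrow> real^'n"
  assumes "poly_fun f" and coords: "\<And>i. \<exists>p. \<forall>t. \<gamma> t $ i = poly p t"
  shows "\<exists>p. \<forall>t. f (\<gamma> t) = poly p t"
  using assms(1)
proof induction
  case (const c)
  show ?case by (rule exI[of _ "[:c:]"]) simp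
next
  case (coord i)
  show ?case using coords[of i] by simp
next
  case (add f g)
  then obtain p q where "\<forall>t. f (\<gamma> t) = poly p t" "\<forall>t. g (\<gamma> t) = poly q t" by blast
  then show ?case by (intro exI[of _ "p + q"]) simp
next
  case (mult f g)
  then obtain p q where "\<forall>t. f (\<gamma> t) = poly p t" "\<forall>t. g (\<gamma> t) = poly q t" by blast
  then show ?case by (intro exI[of _ "p * q"]) simp
qed

text \<open>Hence the pullback of a semi-algebraic set along a polynomial curve is finitely switching.\<close>

lemma semialgebraic_pullback_finitely_switching:
  fixes \<gamma> :: "real \<Rightarrow> real^'n"
  assumes "semialgebraic S" and coords: "\<And>i. \<exists>p. \<forall>t. \<gamma> t $ i = poly p t"
  shows "finitely_switching {t. \<gamma> t \<in> S}"
proof -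
  from assms(1) obtain s :: nat and r :: "nat \<Rightarrow> nat"
    and f :: "nat \<Rightarrow> nat \<Rightarrow> real^'n \<Rightarrow> real" and lt :: "nat \<Rightarrow> nat \<Rightarrow> bool" where polys: "\<forall>i<s. \<forall>j<r i. poly_fun (f i j)"
    and S: "S = (\<Union>i<s. \<Inter>j<r i. {x. if lt i j then f i j x < 0 else f i j x = 0})"
    unfolding semialgebraic_def by blast
  have "{t. \<gamma> t \<in> S} =
      (\<Union>i<s. \<Inter>j<r i. {t. if lt i j then f i j (\<gamma> t) < 0 else f i j (\<gamma> t) = 0})"
    using S by auto
  also have "finitely_switching \<dots>"
  proof (intro finitely_switching_Union finitely_switching_Inter)
    fix i j assume "i < s" "j < r i"
    then obtain p where "\<forall>t. f i j (\<gamma> t) = poly p t"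
      using poly_fun_along_poly_curve[OF _ coords] polys by blast
    then show "finitely_switching {t. if lt i j then f i j (\<gamma> t) < 0 else f i j (\<gamma> t) = 0}"
      using finitely_switching_poly_sign[of p] by (cases "lt i j") simp_all
  qed
  finally show ?thesis .
qed

text \<open>The concrete loop: A is a unipotent Jordan-type matrix whose powers produce a quadratic
  in k in the first coordinate, and B reads off that coordinate.\<close>

definition A_loop :: "real^3^3" where
  "A_loop = vector [vector [1,1,1], vector [0,1,2], vector [0,0,1]]"

definition B_loop :: "real^3^1" where
  "B_loop = vector [vector [1,0,0]]"

lemma A_loop_power:
  "((*v) A_loop ^^ k) x =
     vector [x$3 * (real k)^2 + x$2 * real k + x$1, x$2 + 2 * x$3 * real k, x$3]"
proof (induction k)
  case 0
  then show ?case by (simp add: vec_eq_iff forall_3)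
next
  case (Suc k)
  then show ?case
    by (simp add: vec_eq_iff forall_3 A_loop_def matrix_vector_mult_def sum_3
        algebra_simps power2_eq_square)
qed

lemma NT_loop: "NT A_loop B_loop = {x. \<forall>k::nat. x$3 * (real k)^2 + x$2 * real k + x$1 \<ge> 0}"
  unfolding NT_def by (simp add: A_loop_power B_loop_def matrix_vector_mult_def sum_3)

text \<open>Along this curve the quadratic becomes (k - t)^2 - 1/16.\<close>

definition curve :: "real \<Rightarrow> real^3" where
  "curve t = vector [t^2 - 1/16, -2*t, 1]"

lemma curve_polynomial: "\<exists>p. \<forall>t. curve t $ i = poly p t"
proof -
  consider "i = 1" | "i = 2" | "i = 3" using exhaust_3 by blast
  then show ?thesis
  proof cases
    case 1
    then show ?thesis by (intro exI[of _ "[:-1/16, 0, 1:]"]) (simp add: curve_def power2_eq_square)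
  next
    case 2
    then show ?thesis by (intro exI[of _ "[:0, -2:]"]) (simp add: curve_def)
  next
    case 3
    then show ?thesis by (intro exI[of _ "[:1:]"]) (simp add: curve_def)
  qed
qed

lemma NT_loop_along_curve:
  "{t. curve t \<in> NT A_loop B_loop} = {t. \<forall>k::nat. 1/4 \<le> \<bar>real k - t\<bar>}"
proof -
  have "1/16 \<le> d^2 \<longleftrightarrow> 1/4 \<le> \<bar>d\<bar>" for d :: real
    using abs_le_square_iff[of "1/4" d] by (simp add: power2_eq_square)
  moreover have "curve t \<in> NT A_loop B_loop \<longleftrightarrow> (\<forall>k::nat. 1/16 \<le> (real k - t)^2)" for t
    unfolding NT_loop by (simp add: curve_def power2_eq_square algebra_simps)
  ultimately show ?thesis by simp
qed

text \<open>The trace leaves the set at n + 1/8 and is inside it at n + 1/4, for every n.\<close>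

lemma trace_not_finitely_switching:
  "\<not> finitely_switching {t. \<forall>k::nat. 1/4 \<le> \<bar>real k - t\<bar>}"
proof (rule not_finitely_switching_if_unbounded_switches)
  fix M :: real
  define n :: nat where "n = nat \<lceil>M\<rceil> + 1"
  let ?S = "{t. \<forall>k::nat. 1/4 \<le> \<bar>real k - t\<bar>}"
  have "M < real n + 1/8" unfolding n_def by linarith
  moreover have "real n + 1/8 \<notin> ?S" by (auto intro: exI[of _ n])
  moreover have "real n + 1/4 \<in> ?S"
  proof (intro CollectI allI)
    fix k :: nat
    show "1/4 \<le> \<bar>real k - (real n + 1/4)\<bar>" by (cases "k \<le> n") auto
  qed
  ultimately show "\<exists>a b. M < a \<and> a \<le> b \<and>
      (a \<in> {t. \<forall>k::nat. 1/4 \<le> \<bar>real k - t\<bar>} \<longleftrightarrow> b \<notin> {t. \<forall>k::nat. 1/4 \<le> \<bar>real k - t\<bar>})"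
    by (intro exI[of _ "real n + 1/8"] exI[of _ "real n + 1/4"]) auto
qed

theorem theorem2:
  shows "\<exists>(A::real^3^3) (B::real^3^1). \<not> semialgebraic (NT A B)"
proof (intro exI notI)
  assume "semialgebraic (NT A_loop B_loop)"
  then have "finitely_switching {t. curve t \<in> NT A_loop B_loop}"
    using curve_polynomial by (rule semialgebraic_pullback_finitely_switching)
  then show False
    using trace_not_finitely_switching by (simp add: NT_loop_along_curve)
qed

end
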